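(* In a market with production costs $(S,B,\mathbf v,\mathbf c,G)$, let $\beta=\sum_{j\in S}c_j/W^\star(S,B,\mathbf v,\mathbf c,G)$ denote the fraction of cost to optimal welfare. The Price of Anarchy of the Platform Equilibrium, when the platform sets a transaction fee $\alpha\in[0,1)$, is at most $\frac{2-\alpha}{1-\alpha-\alpha\beta}$.
   Context: A market with costs $(S,B,\mathbf v,\mathbf c,G)$ consists of a finite set $B$ of unit-demand buyers, a finite set $S$ of sellers each owning one item, a production cost $c_j\ge0$ for each seller $j$, values $v_{ij}$ of buyer $i$ for seller $j$'s item, and a bipartite graph $G$ between $B$ and $S$ of pairs that can transact directly. It is assumed that all sellers transact, modeled as follows: besides ordinary buyers (with $v_{ij}\ge0$), $B$ contains for each seller $j$ a dummy buyer $i_j$, linked to $j$ in $G$, with value $v_{i_j,j}=c_j$ and $v_{i_j,j'}=-\infty$ for $j'\ne j$. The social welfare of an allocation (matching) $\mathbf a$ is $\sum_{i,j}a_{ij}(v_{ij}-c_j)$, and $W(S,B,\mathbf v,\mathbf c,G')$ is the maximum social welfare over matchings using only edges of the graph $G'$. The optimal welfare is $W^\star(S,B,\mathbf v,\mathbf c,G)=W(S,B,\mathbf v,\mathbf c,K)$ with $K$ the complete bipartite graph between $B$ and $S$. For a set $P\subseteq S$ of sellers joining the platform, $G(P)$ is obtained from $G$ by adding all edges between $P$ and $B$. The market clears in a competitive equilibrium for values $\mathbf v$ on $G(P)$ at the maximum competitive prices $p_j(P)$. (A competitive equilibrium on a graph $G'$ is a pair of nonnegative prices $\mathbf p$ and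 a matching $\mathbf a$ using edges of $G'$ such that every buyer $i$ has utility $\sum_j a_{ij}(v_{ij}-p_j)$ that is nonnegative and at least $v_{ij}-p_j$ for each seller $j$ linked to $i$ in $G'$, and unassigned items have price $0$; competitive prices form a lattice, so coordinatewise maximum prices exist.) The resulting social welfare is $W(S,B,\mathbf v,\mathbf c,G(P))$. At fee $\alpha$, seller $j$ has utility $u_j(P,\alpha)=(1-\alpha)p_j(P)-c_j$ if $j\in P$ and $u_j(P,\alpha)=p_j(P)-c_j$ if $j\notin P$. A vector $\mathbf x\in[0,1]^S$ (seller $j$ joins independently with probability $x_j$; $P\sim\mathbf x$ is the resulting random set of joining sellers) is a Platform Equilibrium at fee $\alpha$ if for every $j$, $\mathbb E_{P\sim\mathbf x}[u_j(P,\alpha)]\ge\max\{\mathbb E_{P\sim\mathbf x_{-j}}[u_j(P,\alpha)],\mathbb E_{P\sim\mathbf x_{-j}}[u_j(P\cup\{j\},\alpha)]\}$, where $P\sim\mathbf x_{-j}$ is the random set of joining sellers other than $j$; it is pure if $\mathbf x\in\{0,1\}^S$ and mixed in general. The Price of Anarchy at fee $\alpha$ is the worst-case ratio $W^\star(S,B,\mathbf v,\mathbf c,G)/\mathbb E_{P\sim\mathbf x}[W(S,B,\mathbf v,\mathbf c,G(P))]$ over the (pure or mixed) Platform Equilibria $\mathbf x$ at fee $\alpha$.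
   Formalization: The formal theorem adds the assumption 1−α−αβ > 0; without it the stated bound is undefined or negative, while the Price of Anarchy is at least 1, so the claim fails. *)

theory Defs
  imports "HOL-Probability.Probability"
begin

text \<open>Graphs between buyers and sellers are sets of pairs (buyer, seller). Values are extended
  reals only because a dummy buyer has value \<open>-\<infinity>\<close> for every item except her own.\<close>

definition market_with_costs ::
  "'s set \<Rightarrow> 'b set \<Rightarrow> ('b \<Rightarrow> 's \<Rightarrow> ereal) \<Rightarrow> ('s \<Rightarrow> real) \<Rightarrow> ('b \<times> 's) set \<Rightarrow> bool" where
  "market_with_costs S B v c G \<longleftrightarrow>
     finite S \<and> finite B \<and> G \<subseteq> B \<times> S \<and> (\<forall>j\<in>S. 0 \<le> c j) \<and>
     (\<exists>dummy. inj_on dummy S \<and> dummy ` S \<subseteq> B \<and>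
        (\<forall>j\<in>S. (dummy j, j) \<in> G \<and> v (dummy j) j = ereal (c j) \<and>
               (\<forall>j'\<in>S. j' \<noteq> j \<longrightarrow> v (dummy j) j' = -\<infinity>)) \<and>
        (\<forall>i\<in>B - dummy ` S. \<forall>j\<in>S. 0 \<le> v i j \<and> v i j < \<infinity>))"

text \<open>An allocation with indicators \<open>a\<^sub>i\<^sub>j\<close> is represented by its set of pairs with \<open>a\<^sub>i\<^sub>j = 1\<close>.\<close>

definition is_matching :: "('b \<times> 's) set \<Rightarrow> ('b \<times> 's) set \<Rightarrow> bool" where
  "is_matching E M \<longleftrightarrow> M \<subseteq> E \<and> inj_on fst M \<and> inj_on snd M"

definition social_welfare :: "('b \<Rightarrow> 's \<Rightarrow> ereal) \<Rightarrow> ('s \<Rightarrow> real) \<Rightarrow> ('b \<times> 's) set \<Rightarrow> ereal" where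
  "social_welfare v c M = (\<Sum>(i, j)\<in>M. v i j - ereal (c j))"

text \<open>The conversion to a real loses nothing in a market: the empty matching has welfare \<open>0\<close>
  and no value is \<open>\<infinity>\<close>, so the maximum is finite.\<close>

definition max_welfare :: "('b \<Rightarrow> 's \<Rightarrow> ereal) \<Rightarrow> ('s \<Rightarrow> real) \<Rightarrow> ('b \<times> 's) set \<Rightarrow> real" where
  "max_welfare v c E = real_of_ereal (Max (social_welfare v c ` {M. is_matching E M}))"

definition optimal_welfare ::
  "'s set \<Rightarrow> 'b set \<Rightarrow> ('b \<Rightarrow> 's \<Rightarrow> ereal) \<Rightarrow> ('s \<Rightarrow> real) \<Rightarrow> real" where
  "optimal_welfare S B v c = max_welfare v c (B \<times> S)"

definition platform_graph :: "'b set \<Rightarrow> ('b \<times> 's) set \<Rightarrow> 's set \<Rightarrow> ('b \<times> 's) set" where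
  "platform_graph B G P = G \<union> B \<times> P"

definition buyer_utility ::
  "('b \<Rightarrow> 's \<Rightarrow> ereal) \<Rightarrow> ('s \<Rightarrow> real) \<Rightarrow> ('b \<times> 's) set \<Rightarrow> 'b \<Rightarrow> ereal" where
  "buyer_utility v p M i = (\<Sum>j | (i, j) \<in> M. v i j - ereal (p j))"

definition competitive_equilibrium ::
  "'s set \<Rightarrow> 'b set \<Rightarrow> ('b \<Rightarrow> 's \<Rightarrow> ereal) \<Rightarrow> ('b \<times> 's) set \<Rightarrow>
   ('s \<Rightarrow> real) \<Rightarrow> ('b \<times> 's) set \<Rightarrow> bool" where
  "competitive_equilibrium S B v E p M \<longleftrightarrow>
     (\<forall>j\<in>S. 0 \<le> p j) \<and> is_matching E M \<and>
     (\<forall>i\<in>B. 0 \<le> buyer_utility v p M i \<and>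
            (\<forall>j\<in>S. (i, j) \<in> E \<longrightarrow> v i j - ereal (p j) \<le> buyer_utility v p M i)) \<and>
     (\<forall>j\<in>S. j \<notin> snd ` M \<longrightarrow> p j = 0)"

definition competitive_prices ::
  "'s set \<Rightarrow> 'b set \<Rightarrow> ('b \<Rightarrow> 's \<Rightarrow> ereal) \<Rightarrow> ('b \<times> 's) set \<Rightarrow> ('s \<Rightarrow> real) \<Rightarrow> bool" where
  "competitive_prices S B v E p \<longleftrightarrow> (\<exists>M. competitive_equilibrium S B v E p M)"

definition maximum_competitive_prices ::
  "'s set \<Rightarrow> 'b set \<Rightarrow> ('b \<Rightarrow> 's \<Rightarrow> ereal) \<Rightarrow> ('b \<times> 's) set \<Rightarrow> ('s \<Rightarrow> real) \<Rightarrow> bool" where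
  "maximum_competitive_prices S B v E p \<longleftrightarrow>
     competitive_prices S B v E p \<and>
     (\<forall>q. competitive_prices S B v E q \<longrightarrow> (\<forall>j\<in>S. q j \<le> p j))"

text \<open>Maximum competitive prices are determined only on \<open>S\<close>, so the description is applied to
  the price of one seller \<open>j \<in> S\<close> rather than to the price function.\<close>

definition max_price ::
  "'s set \<Rightarrow> 'b set \<Rightarrow> ('b \<Rightarrow> 's \<Rightarrow> ereal) \<Rightarrow> ('b \<times> 's) set \<Rightarrow> 's \<Rightarrow> real" where
  "max_price S B v E j = (THE r. \<exists>p. maximum_competitive_prices S B v E p \<and> r = p j)"

definition seller_utility ::
  "'s set \<Rightarrow> 'b set \<Rightarrow> ('b \<Rightarrow> 's \<Rightarrow> ereal) \<Rightarrow> ('s \<Rightarrow> real) \<Rightarrow> ('b \<times> 's) set \<Rightarrow>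
   real \<Rightarrow> 's set \<Rightarrow> 's \<Rightarrow> real" where
  "seller_utility S B v c G \<alpha> P j =
     (if j \<in> P then (1 - \<alpha>) * max_price S B v (platform_graph B G P) j - c j
      else max_price S B v (platform_graph B G P) j - c j)"

text \<open>The random set of joining sellers when each seller \<open>j \<in> T\<close> joins independently with
  probability \<open>x j\<close> and nobody outside \<open>T\<close> joins. Taking \<open>T = S\<close> gives \<open>P \<sim> x\<close>, and
  \<open>T = S - {j}\<close> gives \<open>P \<sim> x\<^sub>-\<^sub>j\<close>.\<close>

definition joining_sellers :: "'s set \<Rightarrow> ('s \<Rightarrow> real) \<Rightarrow> 's set pmf" where
  "joining_sellers T x =
     map_pmf (\<lambda>f. {j\<in>T. f j}) (Pi_pmf T False (\<lambda>j. bernoulli_pmf (x j)))"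

definition platform_equilibrium ::
  "'s set \<Rightarrow> 'b set \<Rightarrow> ('b \<Rightarrow> 's \<Rightarrow> ereal) \<Rightarrow> ('s \<Rightarrow> real) \<Rightarrow> ('b \<times> 's) set \<Rightarrow>
   real \<Rightarrow> ('s \<Rightarrow> real) \<Rightarrow> bool" where
  "platform_equilibrium S B v c G \<alpha> x \<longleftrightarrow>
     (\<forall>j\<in>S. 0 \<le> x j \<and> x j \<le> 1) \<and>
     (\<forall>j\<in>S. measure_pmf.expectation (joining_sellers S x) (\<lambda>P. seller_utility S B v c G \<alpha> P j)
        \<ge> max (measure_pmf.expectation (joining_sellers (S - {j}) x)
                 (\<lambda>P. seller_utility S B v c G \<alpha> P j))
              (measure_pmf.expectation (joining_sellers (S - {j}) x)
                 (\<lambda>P. seller_utility S B v c G \<alpha> (P \<union> {j}) j)))"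

text \<open>Extended-real division makes the ratio \<open>\<infinity>\<close> when the expected welfare of an equilibrium is
  \<open>0\<close> although the optimal welfare is positive; the ratio \<open>0 / 0\<close> is \<open>0\<close>.\<close>

definition price_of_anarchy ::
  "'s set \<Rightarrow> 'b set \<Rightarrow> ('b \<Rightarrow> 's \<Rightarrow> ereal) \<Rightarrow> ('s \<Rightarrow> real) \<Rightarrow> ('b \<times> 's) set \<Rightarrow> real \<Rightarrow> ereal" where
  "price_of_anarchy S B v c G \<alpha> =
     (SUP x\<in>{x. platform_equilibrium S B v c G \<alpha> x}.
        ereal (optimal_welfare S B v c) /
        ereal (measure_pmf.expectation (joining_sellers S x)
                 (\<lambda>P. max_welfare v c (platform_graph B G P))))"

end

theory Submission
  imports Defs
begin

text \<open>The maximum competitive price of an item \<open>j\<close> on a graph \<open>H\<close> is \<open>V(H) - V(H - j)\<close>, where \<open>V\<close> is the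
  maximum total value of a matching. If \<open>j\<close> joins the platform, it can be sold to the buyer \<open>i\<close> who gets
  it in the welfare optimum. As buyers and items are complements, its new price is therefore at
  least \<open>v\<^sub>i\<^sub>j\<close> minus the marginal contribution \<open>V(H) - V(H - i)\<close> of \<open>i\<close>. The dummy buyers force prices
  to cover costs, so the contributions of all ordinary buyers add up to at most \<open>W(H)\<close>. Hence the
  prices that the sellers would get by joining sum to at least \<open>W\<^sup>\<star> + \<Sum>c - W\<close>, while the profits sum to
  at most \<open>W\<close>. In equilibrium joining is not profitable, which gives
  \<open>E W \<ge> (1 - \<alpha>) (W\<^sup>\<star> + \<Sum>c - E W) - \<Sum>c\<close>.\<close>

section \<open>Maximum weight matchings\<close>

lemma is_matching_empty [simp]: "is_matching E {}"
  by (simp add: is_matching_def)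

lemma is_matching_mono: "is_matching E M \<Longrightarrow> E \<subseteq> E' \<Longrightarrow> is_matching E' M"
  by (auto simp: is_matching_def)

lemma is_matching_subset: "is_matching E M \<Longrightarrow> M' \<subseteq> M \<Longrightarrow> is_matching E M'"
  by (auto simp: is_matching_def intro: inj_on_subset)

lemma is_matching_insert:
  assumes "is_matching E M" "(i, j) \<in> E" "i \<notin> fst ` M" "j \<notin> snd ` M"
  shows "is_matching E (insert (i, j) M)"
  using assms by (auto simp: is_matching_def inj_on_insert)

lemma is_matching_unique_snd:
  assumes "is_matching E M" "(i, j) \<in> M" "(i, k) \<in> M" shows "j = k"
  using assms inj_onD[of fst M "(i, j)" "(i, k)"] by (auto simp: is_matching_def)

lemma is_matching_unique_fst:
  assumes "is_matching E M" "(i, k) \<in> M" "(j, k) \<in> M" shows "i = j"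
  using assms inj_onD[of snd M "(i, k)" "(j, k)"] by (auto simp: is_matching_def)

lemma finite_matchings: "finite E \<Longrightarrow> finite {M. is_matching E M}"
  by (rule finite_subset[of _ "Pow E"]) (auto simp: is_matching_def)

lemma finite_matching: "finite E \<Longrightarrow> is_matching E M \<Longrightarrow> finite M"
  by (auto simp: is_matching_def intro: finite_subset)

definition max_weight :: "('b \<times> 's \<Rightarrow> real) \<Rightarrow> ('b \<times> 's) set \<Rightarrow> real" where
  "max_weight w E = Max (sum w ` {M. is_matching E M})"

lemma max_weight_ge: "finite E \<Longrightarrow> is_matching E M \<Longrightarrow> sum w M \<le> max_weight w E"
  unfolding max_weight_def by (rule Max_ge) (auto intro: finite_matchings)

lemma max_weight_attained:
  assumes "finite E"
  obtains M where "is_matching E M" "sum w M = max_weight w E"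
proof -
  have "max_weight w E \<in> sum w ` {M. is_matching E M}"
    unfolding max_weight_def using assms
    by (intro Max_in) (auto intro: finite_matchings exI[of _ "{}"])
  then show ?thesis using that by auto
qed

lemma max_weight_mono:
  assumes "finite E'" "E \<subseteq> E'" shows "max_weight w E \<le> max_weight w E'"
proof -
  obtain M where "is_matching E M" "sum w M = max_weight w E"
    using max_weight_attained assms finite_subset by metis
  then show ?thesis using max_weight_ge[OF assms(1), of M w] is_matching_mono assms(2) by metis
qed

section \<open>Deleting an item or a buyer, and exchange arguments\<close>

definition without_item :: "('b \<times> 's) set \<Rightarrow> 's \<Rightarrow> ('b \<times> 's) set" where
  "without_item E j = {e \<in> E. snd e \<noteq> j}"

definition without_buyer :: "('b \<times> 's) set \<Rightarrow> 'b \<Rightarrow> ('b \<times> 's) set" where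
  "without_buyer E i = {e \<in> E. fst e \<noteq> i}"

lemma is_matching_without_item:
  "is_matching (without_item E j) M \<longleftrightarrow> is_matching E M \<and> j \<notin> snd ` M"
  by (auto simp: is_matching_def without_item_def)

lemma is_matching_without_buyer:
  "is_matching (without_buyer E i) M \<longleftrightarrow> is_matching E M \<and> i \<notin> fst ` M"
  by (auto simp: is_matching_def without_buyer_def)

lemma finite_without [simp]:
  "finite E \<Longrightarrow> finite (without_item E j)" "finite E \<Longrightarrow> finite (without_buyer E i)"
  by (simp_all add: without_item_def without_buyer_def)

text \<open>Swap \<open>N\<close> and \<open>L\<close> along the alternating path that starts at \<open>j\<close> with an edge of \<open>L\<close>: it meets
  every buyer through an edge of \<open>L\<close>, hence never reaches \<open>i\<close>.\<close>

lemma matching_exchange: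
  fixes E :: "('b \<times> 's) set"
  assumes N: "is_matching E N" and L: "is_matching E L" and fin: "finite E"
    and j: "j \<notin> snd ` N" and i: "i \<notin> fst ` L"
  obtains N' L' where "is_matching E N'" "is_matching E L'"
    "sum w N' + sum w L' = sum w N + (sum w L :: real)"
    "i \<notin> fst ` L'" "j \<notin> snd ` L'"
    "\<And>k. k \<notin> snd ` L \<Longrightarrow> k \<notin> snd ` N' \<or> k \<notin> snd ` L'"
proof -
  \<comment> \<open>\<open>T\<close> follows the alternating path: from an item, along its
    \<open>L\<close>-edge to a buyer, then along her \<open>N\<close>-edge to the next item.
    \<open>Y\<close> collects the items on the path from \<open>j\<close>, \<open>X\<close> the
    buyers. Every edge of either matching has both ends on the path or neither.\<close>
  define T where "T = {(s, s'). \<exists>b. (b, s) \<in> L \<and> (b, s') \<in> N}"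
  define Y where "Y = T\<^sup>* `` {j}"
  define X where "X = {b. \<exists>s\<in>Y. (b, s) \<in> L}"
  have LXY: "b \<in> X \<longleftrightarrow> s \<in> Y" if "(b, s) \<in> L" for b s
    using that is_matching_unique_snd[OF L] by (auto simp: X_def)
  have NXY: "b \<in> X \<longleftrightarrow> s \<in> Y" if "(b, s) \<in> N" for b s
  proof
    assume "b \<in> X"
    then obtain s0 where s0: "s0 \<in> Y" "(b, s0) \<in> L" by (auto simp: X_def)
    then have "(s0, s) \<in> T" using that by (auto simp: T_def)
    then show "s \<in> Y" using s0(1) by (auto simp: Y_def intro: rtrancl_into_rtrancl)
  next
    assume "s \<in> Y"
    then have "(j, s) \<in> T\<^sup>*" by (simp add: Y_def)
    \<comment> \<open>As \<open>N\<close> misses \<open>j\<close>, the item \<open>s\<close> is not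
      the start of the path, so the path has a last step, and that step enters \<open>s\<close>
      through its \<open>N\<close>-edge.\<close>
    moreover have "s \<noteq> j" using that j by force
    ultimately have "(j, s) \<in> T\<^sup>+" by (simp add: rtrancl_eq_or_trancl)
    then obtain s0 where s0: "(j, s0) \<in> T\<^sup>*" "(s0, s) \<in> T"
      by (meson tranclD2)
    then obtain b0 where "(b0, s0) \<in> L" "(b0, s) \<in> N" by (auto simp: T_def)
    then show "b \<in> X"
      using s0(1) that is_matching_unique_fst[OF N] by (auto simp: X_def Y_def)
  qed
  \<comment> \<open>Taking one matching off the path and the other on it leaves a matching because
    all candidate edges of a buyer lie on the same side, decided by \<open>X\<close>. The two ways
    of mixing use each edge of \<open>N\<close> and \<open>L\<close> equally often as
    before.\<close>
  define mix where "mix = (\<lambda>A A' :: ('b \<times> 's) set. {e \<in> A. snd e \<notin> Y} \<union> {e \<in> A'. snd e \<in> Y})"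
  have mix: "is_matching E (mix A A')"
    if A: "is_matching E A" "is_matching E A'"
      and AX: "\<And>b s. (b, s) \<in> A \<Longrightarrow> b \<in> X \<longleftrightarrow> s \<in> Y"
      and A'X: "\<And>b s. (b, s) \<in> A' \<Longrightarrow> b \<in> X \<longleftrightarrow> s \<in> Y" for A A'
  proof -
    have "s = t" if e: "(b, s) \<in> mix A A'" "(b, t) \<in> mix A A'" for b s t
    proof (cases "b \<in> X")
      case True
      then have "(b, s) \<in> A'" "(b, t) \<in> A'" using e AX by (auto simp: mix_def)
      then show ?thesis by (rule is_matching_unique_snd[OF A(2)])
    next
      case False
      then have "(b, s) \<in> A" "(b, t) \<in> A" using e A'X by (auto simp: mix_def)
      then show ?thesis by (rule is_matching_unique_snd[OF A(1)])
    qed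
    then have "inj_on fst (mix A A')" by (auto simp: inj_on_def)
    moreover have "b = d" if "(b, s) \<in> mix A A'" "(d, s) \<in> mix A A'" for b d s
      using that is_matching_unique_fst[OF A(1), of b s d] is_matching_unique_fst[OF A(2), of b s d]
      by (auto simp: mix_def)
    then have "inj_on snd (mix A A')" by (auto simp: inj_on_def)
    ultimately show ?thesis using A by (auto simp: is_matching_def mix_def)
  qed
  have sum_mix: "sum w (mix A A') = sum w {e \<in> A. snd e \<notin> Y} + sum w {e \<in> A'. snd e \<in> Y}"
    if "finite A" "finite A'" for A A'
    unfolding mix_def by (rule sum.union_disjoint) (use that in auto)
  have split: "sum w A = sum w {e \<in> A. snd e \<notin> Y} + sum w {e \<in> A. snd e \<in> Y}" if "finite A" for A
    by (subst sum.union_disjoint[symmetric]) (use that in \<open>auto intro: arg_cong[of _ _ "sum w"]\<close>)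
  have finNL: "finite N" "finite L" using finite_matching fin N L by auto
  have iX: "i \<notin> X" using i by (force simp: X_def)
  have jY: "j \<in> Y" by (simp add: Y_def)
  show ?thesis
  proof (rule that[of "mix N L" "mix L N"])
    show "is_matching E (mix N L)" "is_matching E (mix L N)"
      using mix[OF N L NXY LXY] mix[OF L N LXY NXY] by simp_all
    show "sum w (mix N L) + sum w (mix L N) = sum w N + sum w L"
      using sum_mix[OF finNL] sum_mix[OF finNL(2,1)] split[OF finNL(1)] split[OF finNL(2)] by linarith
    show "i \<notin> fst ` mix L N" using i iX NXY by (force simp: mix_def)
    show "j \<notin> snd ` mix L N" using j jY by (force simp: mix_def)
    \<comment> \<open>An item that \<open>L\<close> misses is absent from \<open>mix N L\<close> if
      it lies in \<open>Y\<close>, and from \<open>mix L N\<close> otherwise.\<close>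
    show "k \<notin> snd ` mix N L \<or> k \<notin> snd ` mix L N" if "k \<notin> snd ` L" for k
      using that by (force simp: mix_def)
  qed
qed

text \<open>Buyers and items are complements: the marginal contribution of \<open>j\<close> is at
  least as large with buyer \<open>i\<close> present as without her. An optimum avoiding
  \<open>j\<close> and one avoiding \<open>i\<close> are exchanged into a matching that may use both
  and one that avoids both.\<close>

lemma max_weight_complements:
  assumes fin: "finite E"
  shows "max_weight w (without_item E j) + max_weight w (without_buyer E i)
    \<le> max_weight w E + max_weight w (without_buyer (without_item E j) i)"
proof -
  obtain N where N: "is_matching (without_item E j) N" "sum w N = max_weight w (without_item E j)"
    using max_weight_attained fin finite_without by metis
  obtain L where L: "is_matching (without_buyer E i) L" "sum w L = max_weight w (without_buyer E i)"
    using max_weight_attained fin finite_without by metis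
  obtain N' L' where NL: "is_matching E N'" "is_matching E L'"
    "sum w N' + sum w L' = sum w N + sum w L" "i \<notin> fst ` L'" "j \<notin> snd ` L'"
    using matching_exchange[of E N L j i w] N(1) L(1) fin
    unfolding is_matching_without_item is_matching_without_buyer by metis
  have "sum w N' \<le> max_weight w E" using NL fin by (intro max_weight_ge)
  moreover have "sum w L' \<le> max_weight w (without_buyer (without_item E j) i)"
    using NL fin by (intro max_weight_ge) (simp_all add: is_matching_without_item is_matching_without_buyer)
  ultimately show ?thesis using N L NL by linarith
qed

text \<open>At prices V(E) - V(E - j), a buyer who gets \<open>k\<close> in an optimal matching does
  not prefer \<open>j\<close>. Her edge is removed from the optimum, the rest is exchanged with an
  optimum avoiding \<open>j\<close>, and she is then given \<open>j\<close>.\<close>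

lemma max_weight_envy_free:
  assumes fin: "finite E" and M: "is_matching E M" "sum w M = max_weight w E"
    and ik: "(i, k) \<in> M" and ij: "(i, j) \<in> E"
  shows "w (i, j) + max_weight w (without_item E j) \<le> w (i, k) + max_weight w (without_item E k)"
proof (cases "j = k")
  case False
  define L where "L = M - {(i, k)}"
  have finM: "finite M" using fin M finite_matching by blast
  have L: "is_matching E L" "i \<notin> fst ` L" "k \<notin> snd ` L"
    using M(1) is_matching_subset[OF M(1)] ik is_matching_unique_snd[OF M(1)]
      is_matching_unique_fst[OF M(1)] by (force simp: L_def)+
  have sumL: "sum w M = w (i, k) + sum w L"
    unfolding L_def using finM ik by (rule sum.remove)
  obtain N where N: "is_matching (without_item E j) N" "sum w N = max_weight w (without_item E j)"
    using max_weight_attained fin finite_without by metis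
  obtain N' L' where NL: "is_matching E N'" "is_matching E L'"
    "sum w N' + sum w L' = sum w N + sum w L" "i \<notin> fst ` L'" "j \<notin> snd ` L'"
    "k \<notin> snd ` N' \<or> k \<notin> snd ` L'"
    using matching_exchange[of E N L j i w] N(1) L fin
    unfolding is_matching_without_item by metis
  have L'j: "is_matching E (insert (i, j) L')" using NL ij by (intro is_matching_insert)
  have "(i, j) \<notin> L'" using NL(4) by force
  then have sumL': "sum w (insert (i, j) L') = w (i, j) + sum w L'"
    using finite_matching[OF fin NL(2)] by simp
  \<comment> \<open>One of the two resulting matchings still misses \<open>k\<close> and is bounded
    by the optimum without \<open>k\<close>; the other is bounded by the full optimum.\<close>
  have "w (i, j) + sum w L' + sum w N' \<le> max_weight w (without_item E k) + max_weight w E"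
    using NL(6)
  proof
    assume "k \<notin> snd ` N'"
    then have "sum w N' \<le> max_weight w (without_item E k)"
      using NL fin by (intro max_weight_ge) (simp_all add: is_matching_without_item)
    then show ?thesis using max_weight_ge[OF fin L'j, of w] sumL' by linarith
  next
    assume "k \<notin> snd ` L'"
    then have "sum w (insert (i, j) L') \<le> max_weight w (without_item E k)"
      using L'j fin False by (intro max_weight_ge) (auto simp: is_matching_without_item)
    then show ?thesis using max_weight_ge[OF fin NL(1), of w] sumL' by linarith
  qed
  then show ?thesis using N(2) NL(3) sumL M(2) by linarith
qed simp

section \<open>Maximum competitive prices\<close>

lemma buyer_utility_matched:
  assumes "is_matching E M" "(i, j) \<in> M"
  shows "buyer_utility v p M i = v i j - ereal (p j)"
proof -
  have "{k. (i, k) \<in> M} = {j}" using assms is_matching_unique_snd by fastforce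
  then show ?thesis by (simp add: buyer_utility_def)
qed

lemma buyer_utility_unmatched: "i \<notin> fst ` M \<Longrightarrow> buyer_utility v p M i = 0"
proof -
  assume "i \<notin> fst ` M"
  then have "{k. (i, k) \<in> M} = {}" by force
  then show ?thesis by (simp add: buyer_utility_def)
qed

section \<open>Marginal contributions of items as maximum competitive prices\<close>

locale assignment_market =
  fixes S :: "'s set" and B :: "'b set" and v :: "'b \<Rightarrow> 's \<Rightarrow> ereal"
  assumes finite_S: "finite S" and finite_B: "finite B"
    and not_infinity: "i \<in> B \<Longrightarrow> j \<in> S \<Longrightarrow> v i j \<noteq> \<infinity>"
begin

text \<open>\<open>real_of_ereal\<close> sends -\<infinity> to 0, so these weights are meaningful
  only on the edges kept by \<open>feasible\<close>.\<close>

definition val :: "'b \<times> 's \<Rightarrow> real" where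
  "val e = real_of_ereal (v (fst e) (snd e))"

definition feasible :: "('b \<times> 's) set \<Rightarrow> ('b \<times> 's) set" where
  "feasible E = {e \<in> E. v (fst e) (snd e) \<noteq> -\<infinity>}"

definition marginal_price :: "('b \<times> 's) set \<Rightarrow> 's \<Rightarrow> real" where
  "marginal_price E j =
     max_weight val (feasible E) - max_weight val (without_item (feasible E) j)"

lemma finite_edges: "E \<subseteq> B \<times> S \<Longrightarrow> finite E"
  using finite_S finite_B by (auto intro: finite_subset)

lemma finite_feasible: "E \<subseteq> B \<times> S \<Longrightarrow> finite (feasible E)"
  using finite_edges[of E] by (simp add: feasible_def)

lemma feasible_subset: "feasible E \<subseteq> E"
  by (auto simp: feasible_def)

lemma v_eq_val:
  assumes "E \<subseteq> B \<times> S" "(i, j) \<in> feasible E" shows "v i j = ereal (val (i, j))"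
  using assms not_infinity[of i j] by (cases "v i j") (auto simp: feasible_def val_def)

lemma marginal_price_nonneg: "E \<subseteq> B \<times> S \<Longrightarrow> 0 \<le> marginal_price E j"
  unfolding marginal_price_def
  using max_weight_mono[of "feasible E" "without_item (feasible E) j" val] finite_feasible[of E]
  by (auto simp: without_item_def)

lemma marginal_price_le_val:
  assumes E: "E \<subseteq> B \<times> S" and M: "is_matching (feasible E) M" "sum val M = max_weight val (feasible E)"
    and ij: "(i, j) \<in> M"
  shows "marginal_price E j \<le> val (i, j)"
proof -
  have "is_matching (without_item (feasible E) j) (M - {(i, j)})"
    using is_matching_subset[OF M(1)] is_matching_unique_fst[OF M(1)] ij
    by (auto simp: is_matching_without_item)
  then have "sum val (M - {(i, j)}) \<le> max_weight val (without_item (feasible E) j)"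
    using finite_feasible[OF E] by (intro max_weight_ge) simp_all
  moreover have "sum val M = val (i, j) + sum val (M - {(i, j)})"
    using finite_matching[OF finite_feasible[OF E] M(1)] ij by (rule sum.remove)
  ultimately show ?thesis using M(2) by (simp add: marginal_price_def)
qed

lemma marginal_price_unmatched:
  assumes E: "E \<subseteq> B \<times> S" and M: "is_matching (feasible E) M" "sum val M = max_weight val (feasible E)"
    and j: "j \<notin> snd ` M"
  shows "marginal_price E j = 0"
proof -
  have "sum val M \<le> max_weight val (without_item (feasible E) j)"
    using M j finite_feasible[OF E] by (intro max_weight_ge) (simp_all add: is_matching_without_item)
  then show ?thesis using M(2) marginal_price_nonneg[OF E, of j] by (simp add: marginal_price_def)
qed

text \<open>Matched buyers are content by \<open>max_weight_envy_free\<close>; for an unmatched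
  buyer, an exchange shows that no item is worth more to her than its marginal contribution.\<close>

lemma competitive_equilibrium_marginal_price:
  assumes E: "E \<subseteq> B \<times> S" and M: "is_matching (feasible E) M" "sum val M = max_weight val (feasible E)"
  shows "competitive_equilibrium S B v E (marginal_price E) M"
proof -
  let ?p = "marginal_price E"
  have mono: "is_matching E M" using M(1) feasible_subset is_matching_mono by blast
  have *: "0 \<le> buyer_utility v ?p M i \<and>
      (\<forall>j\<in>S. (i, j) \<in> E \<longrightarrow> v i j - ereal (?p j) \<le> buyer_utility v ?p M i)" for i
  proof (cases "i \<in> fst ` M")
    case True
    then obtain k where k: "(i, k) \<in> M" by auto
    have kF: "(i, k) \<in> feasible E" using k M(1) by (auto simp: is_matching_def)
    have u: "buyer_utility v ?p M i = ereal (val (i, k) - ?p k)"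
      using buyer_utility_matched[OF mono k] v_eq_val[OF E kF] by simp
    have "v i j - ereal (?p j) \<le> buyer_utility v ?p M i" if "(i, j) \<in> E" for j
    proof (cases "(i, j) \<in> feasible E")
      case True
      from max_weight_envy_free[OF finite_feasible[OF E] M k True]
      show ?thesis unfolding u v_eq_val[OF E True] by (simp add: marginal_price_def)
    next
      case False
      then show ?thesis using that by (simp add: feasible_def)
    qed
    then show ?thesis using u marginal_price_le_val[OF E M k] by auto
  next
    case False
    \<comment> \<open>The optimum \<open>M\<close> leaves \<open>i\<close> free. Exchanging it with
      an optimum avoiding \<open>j\<close> frees \<open>j\<close> as well, so \<open>(i, j)\<close>
      can be added.\<close>
    have "v i j - ereal (?p j) \<le> 0" if "(i, j) \<in> E" for j
    proof (cases "(i, j) \<in> feasible E")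
      case True
      obtain N where N: "is_matching (without_item (feasible E) j) N"
        "sum val N = max_weight val (without_item (feasible E) j)"
        using max_weight_attained finite_feasible[OF E] finite_without by metis
      obtain N' L' where NL: "is_matching (feasible E) N'" "is_matching (feasible E) L'"
        "sum val N' + sum val L' = sum val N + sum val M" "i \<notin> fst ` L'" "j \<notin> snd ` L'"
        using matching_exchange[of "feasible E" N M j i val] N(1) M(1) False finite_feasible[OF E]
        unfolding is_matching_without_item by metis
      have "sum val (insert (i, j) L') \<le> max_weight val (feasible E)"
        using NL True finite_feasible[OF E] by (intro max_weight_ge is_matching_insert)
      moreover have "sum val (insert (i, j) L') = val (i, j) + sum val L'"
        using NL(4) finite_matching[OF finite_feasible[OF E] NL(2)] by (intro sum.insert) force+
      moreover have "sum val N' \<le> max_weight val (feasible E)"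
        using NL finite_feasible[OF E] by (intro max_weight_ge)
      ultimately show ?thesis
        unfolding v_eq_val[OF E True] using N NL(3) M(2) by (simp add: marginal_price_def)
    next
      case False
      then show ?thesis using that by (simp add: feasible_def)
    qed
    then show ?thesis using False by (simp add: buyer_utility_unmatched)
  qed
  show ?thesis
    unfolding competitive_equilibrium_def
    using * mono marginal_price_nonneg[OF E] marginal_price_unmatched[OF E M] by auto
qed

text \<open>Linear programming duality: utilities and prices of an equilibrium form a dual solution
  whose total is the value of its matching. Dropping the price of \<open>j\<close> leaves a dual
  solution for the graph without \<open>j\<close>, so V(E - j) is at most that total minus
  \<open>q j\<close>.\<close>

lemma competitive_price_le_marginal_price:
  assumes E: "E \<subseteq> B \<times> S" and q: "competitive_prices S B v E q" and j: "j \<in> S"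
  shows "q j \<le> marginal_price E j"
proof -
  obtain N where N: "competitive_equilibrium S B v E q N"
    using q by (auto simp: competitive_prices_def)
  then have NE: "is_matching E N" and q0: "\<And>s. s \<in> S \<Longrightarrow> 0 \<le> q s"
    and util0: "\<And>i. i \<in> B \<Longrightarrow> 0 \<le> buyer_utility v q N i"
    and util: "\<And>i s. i \<in> B \<Longrightarrow> s \<in> S \<Longrightarrow> (i, s) \<in> E \<Longrightarrow> v i s - ereal (q s) \<le> buyer_utility v q N i"
    and qunm: "\<And>s. s \<in> S \<Longrightarrow> s \<notin> snd ` N \<Longrightarrow> q s = 0"
    by (auto simp: competitive_equilibrium_def)
  \<comment> \<open>A buyer matched at value -\<infinity> would have negative utility.\<close>
  have "N \<subseteq> feasible E"
  proof
    fix e assume e: "e \<in> N"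
    obtain i s where e_eq: "e = (i, s)" by force
    then have "i \<in> B" "(i, s) \<in> E" using e e_eq NE E by (auto simp: is_matching_def)
    moreover from this have "0 \<le> v i s - ereal (q s)"
      using util0[of i] buyer_utility_matched[OF NE, of i s] e e_eq by simp
    ultimately show "e \<in> feasible E" by (auto simp: feasible_def e_eq)
  qed
  then have NF: "is_matching (feasible E) N" using NE by (auto simp: is_matching_def)
  have finN: "finite N" using finite_matching[OF finite_edges[OF E] NE] .
  have N_sub: "fst ` N \<subseteq> B" "snd ` N \<subseteq> S" using NE E by (force simp: is_matching_def)+
  define u where "u i = real_of_ereal (buyer_utility v q N i)" for i
  have u_matched: "u (fst e) = val e - q (snd e)" "buyer_utility v q N (fst e) = ereal (u (fst e))"
    if "e \<in> N" for e
    using that buyer_utility_matched[OF NE, of "fst e" "snd e" v q]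
      v_eq_val[OF E, of "fst e" "snd e"] \<open>N \<subseteq> feasible E\<close> by (auto simp: u_def)
  have u_unm: "u i = 0" if "i \<notin> fst ` N" for i
    using buyer_utility_unmatched[OF that] by (simp add: u_def)
  have u_eq: "buyer_utility v q N i = ereal (u i)" for i
    using u_matched(2) buyer_utility_unmatched[of i N v q] u_unm[of i] by (cases "i \<in> fst ` N") auto
  have u0: "0 \<le> u i" if "i \<in> B" for i using util0[OF that] u_eq[of i] by simp
  have cover: "val e \<le> u (fst e) + q (snd e)" if "e \<in> feasible E" for e
  proof -
    obtain i s where e_eq: "e = (i, s)" by force
    have "v i s - ereal (q s) \<le> buyer_utility v q N i"
      using that E e_eq feasible_subset[of E] by (intro util) auto
    then show ?thesis using v_eq_val[OF E, of i s] that e_eq u_eq[of i] by simp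
  qed
  \<comment> \<open>Complementary slackness: unmatched buyers have utility 0 and unsold items have
    price 0, so both sums reduce to the edges of \<open>N\<close>.\<close>
  have "(\<Sum>i\<in>B. u i) = (\<Sum>i\<in>fst ` N. u i)"
    using finite_B N_sub u_unm by (intro sum.mono_neutral_right) auto
  also have "\<dots> = (\<Sum>e\<in>N. u (fst e))"
    using NE by (subst sum.reindex) (auto simp: is_matching_def)
  also have "\<dots> = (\<Sum>e\<in>N. val e - q (snd e))" using u_matched by (intro sum.cong) auto
  finally have sumu: "(\<Sum>i\<in>B. u i) = sum val N - (\<Sum>e\<in>N. q (snd e))" by (simp add: sum_subtractf)
  have "(\<Sum>s\<in>S. q s) = (\<Sum>s\<in>snd ` N. q s)"
    using finite_S N_sub qunm by (intro sum.mono_neutral_right) auto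
  also have "\<dots> = (\<Sum>e\<in>N. q (snd e))"
    using NE by (subst sum.reindex) (auto simp: is_matching_def)
  finally have sumq: "(\<Sum>s\<in>S. q s) = (\<Sum>e\<in>N. q (snd e))" .
  obtain L where L: "is_matching (without_item (feasible E) j) L"
    "sum val L = max_weight val (without_item (feasible E) j)"
    using max_weight_attained finite_feasible[OF E] finite_without by metis
  then have LF: "is_matching (feasible E) L" and jL: "j \<notin> snd ` L"
    by (auto simp: is_matching_without_item)
  have L_sub: "fst ` L \<subseteq> B" "snd ` L \<subseteq> S - {j}"
    using LF jL E feasible_subset[of E] by (force simp: is_matching_def)+
  \<comment> \<open>Weak duality for a matching that avoids \<open>j\<close>.\<close>
  have "sum val L \<le> (\<Sum>e\<in>L. u (fst e) + q (snd e))"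
    using cover LF by (intro sum_mono) (auto simp: is_matching_def)
  also have "\<dots> = (\<Sum>i\<in>fst ` L. u i) + (\<Sum>s\<in>snd ` L. q s)"
    using LF by (auto simp: is_matching_def sum.reindex sum.distrib)
  also have "\<dots> \<le> (\<Sum>i\<in>B. u i) + (\<Sum>s\<in>S - {j}. q s)"
    using L_sub finite_S finite_B u0 q0 by (intro add_mono sum_mono2) auto
  also have "(\<Sum>s\<in>S - {j}. q s) = (\<Sum>s\<in>S. q s) - q j"
    using finite_S j by (simp add: sum_diff1)
  finally have "sum val L \<le> sum val N - q j" using sumu sumq by linarith
  then show ?thesis
    using max_weight_ge[OF finite_feasible[OF E] NF, of val] L(2) by (simp add: marginal_price_def)
qed

lemma max_price_eq_marginal_price:
  assumes E: "E \<subseteq> B \<times> S" and j: "j \<in> S"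
  shows "max_price S B v E j = marginal_price E j"
proof -
  obtain M where "is_matching (feasible E) M" "sum val M = max_weight val (feasible E)"
    using max_weight_attained[OF finite_feasible[OF E]] by metis
  from competitive_equilibrium_marginal_price[OF E this]
  have "competitive_prices S B v E (marginal_price E)" by (auto simp: competitive_prices_def)
  then have max: "maximum_competitive_prices S B v E (marginal_price E)"
    using competitive_price_le_marginal_price[OF E] by (simp add: maximum_competitive_prices_def)
  show ?thesis
    unfolding max_price_def
  proof (rule the_equality)
    show "\<exists>p. maximum_competitive_prices S B v E p \<and> marginal_price E j = p j"
      using max by blast
    show "r = marginal_price E j"
      if "\<exists>p. maximum_competitive_prices S B v E p \<and> r = p j" for r
      using that max j by (auto simp: maximum_competitive_prices_def intro!: antisym)
  qed
qed

text \<open>Transfers welfare from extended to real numbers: deleting the pairs of value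
  -\<infinity> from a matching never lowers its welfare.\<close>

lemma max_welfare_eq_max_weight:
  fixes c :: "'s \<Rightarrow> real"
  assumes E: "E \<subseteq> B \<times> S"
  shows "max_welfare v c E = max_weight (\<lambda>e. val e - c (snd e)) (feasible E)"
proof -
  let ?w = "\<lambda>e. val e - c (snd e)"
  have sw: "social_welfare v c M = ereal (sum ?w M)" if "M \<subseteq> feasible E" for M
  proof -
    have "social_welfare v c M = (\<Sum>e\<in>M. ereal (?w e))"
      unfolding social_welfare_def using that by (intro sum.cong) (auto simp: v_eq_val[OF E])
    then show ?thesis by simp
  qed
  obtain M where M: "is_matching (feasible E) M" "sum ?w M = max_weight ?w (feasible E)"
    using max_weight_attained[OF finite_feasible[OF E]] by metis
  have "Max (social_welfare v c ` {M. is_matching E M}) = ereal (max_weight ?w (feasible E))"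
  proof (rule Max_eqI)
    show "finite (social_welfare v c ` {M. is_matching E M})"
      using finite_matchings[OF finite_edges[OF E]] by simp
    have "ereal (max_weight ?w (feasible E)) = social_welfare v c M"
      using sw[of M] M by (simp add: is_matching_def)
    then show "ereal (max_weight ?w (feasible E)) \<in> social_welfare v c ` {M. is_matching E M}"
      using is_matching_mono[OF M(1) feasible_subset] by blast
  next
    fix y assume "y \<in> social_welfare v c ` {M. is_matching E M}"
    then obtain N where N: "is_matching E N" "y = social_welfare v c N" by auto
    let ?N = "N \<inter> feasible E"
    have "y = social_welfare v c ?N + social_welfare v c (N - feasible E)"
      unfolding N(2) social_welfare_def
      using finite_matching[OF finite_edges[OF E] N(1)] by (subst sum.Int_Diff[of _ _ "feasible E"]) auto
    also have "social_welfare v c (N - feasible E) \<le> 0"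
      unfolding social_welfare_def using N(1)
      by (intro sum_nonpos) (auto simp: feasible_def is_matching_def)
    also have "social_welfare v c ?N = ereal (sum ?w ?N)" by (rule sw) simp
    finally have "y \<le> ereal (sum ?w ?N)" by (simp add: add_left_mono)
    moreover have "is_matching (feasible E) ?N"
      using is_matching_subset[OF N(1), of ?N] by (auto simp: is_matching_def)
    then have "sum ?w ?N \<le> max_weight ?w (feasible E)"
      by (rule max_weight_ge[OF finite_feasible[OF E]])
    ultimately show "y \<le> ereal (max_weight ?w (feasible E))" by (meson ereal_less_eq(3) order_trans)
  qed
  then show ?thesis by (simp add: max_welfare_def)
qed

end

section \<open>Production costs\<close>

locale costly_market = assignment_market S B v
  for S :: "'s set" and B :: "'b set" and v :: "'b \<Rightarrow> 's \<Rightarrow> ereal" +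
  fixes c :: "'s \<Rightarrow> real" and G :: "('b \<times> 's) set" and dummy :: "'s \<Rightarrow> 'b"
  assumes G_subset: "G \<subseteq> B \<times> S"
    and cost_nonneg: "j \<in> S \<Longrightarrow> 0 \<le> c j"
    and dummy_edge: "j \<in> S \<Longrightarrow> (dummy j, j) \<in> G"
    and v_dummy: "j \<in> S \<Longrightarrow> v (dummy j) j = ereal (c j)"
    and v_dummy_other: "j \<in> S \<Longrightarrow> k \<in> S \<Longrightarrow> k \<noteq> j \<Longrightarrow> v (dummy j) k = -\<infinity>"
begin

abbreviation net_val :: "'b \<times> 's \<Rightarrow> real" where
  "net_val e \<equiv> val e - c (snd e)"

text \<open>The Vickrey-Clarke-Groves payoff of buyer \<open>i\<close>, computed from values without
  subtracting costs.\<close>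

definition buyer_marginal :: "('b \<times> 's) set \<Rightarrow> 'b \<Rightarrow> real" where
  "buyer_marginal E i =
     max_weight val (feasible E) - max_weight val (without_buyer (feasible E) i)"

lemma val_dummy: "j \<in> S \<Longrightarrow> val (dummy j, j) = c j"
  by (simp add: val_def v_dummy)

lemma dummy_feasible: "G \<subseteq> E \<Longrightarrow> j \<in> S \<Longrightarrow> (dummy j, j) \<in> feasible E"
  using dummy_edge by (auto simp: feasible_def v_dummy)

lemma feasible_dummy_unique:
  assumes "E \<subseteq> B \<times> S" "(dummy j, k) \<in> feasible E" "j \<in> S" shows "k = j"
  using assms v_dummy_other[of j k] by (auto simp: feasible_def)

text \<open>A dummy buyer has one feasible edge only, so she is free whenever her item is.\<close>

lemma is_matching_insert_dummy:
  assumes E: "G \<subseteq> E" "E \<subseteq> B \<times> S" and j: "j \<in> S"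
    and M: "is_matching (feasible E) M" "j \<notin> snd ` M"
  shows "is_matching (feasible E) (insert (dummy j, j) M)" (is ?matching)
    and "sum val (insert (dummy j, j) M) = c j + sum val M" (is ?weight)
proof -
  have "dummy j \<notin> fst ` M"
    using M feasible_dummy_unique[OF E(2) _ j] by (force simp: is_matching_def)
  then show ?matching using M dummy_feasible[OF E(1) j] by (intro is_matching_insert)
  have "(dummy j, j) \<notin> M" using M(2) by force
  then show ?weight
    using finite_matching[OF finite_feasible[OF E(2)] M(1)] val_dummy[OF j] by simp
qed

lemma cost_le_marginal_price:
  assumes E: "G \<subseteq> E" "E \<subseteq> B \<times> S" and j: "j \<in> S"
  shows "c j \<le> marginal_price E j"
proof -
  obtain M where M: "is_matching (without_item (feasible E) j) M"
    "sum val M = max_weight val (without_item (feasible E) j)"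
    using max_weight_attained finite_feasible[OF E(2)] finite_without by metis
  then have "is_matching (feasible E) M" "j \<notin> snd ` M" by (auto simp: is_matching_without_item)
  from is_matching_insert_dummy[OF E j this]
  show ?thesis
    using max_weight_ge[OF finite_feasible[OF E(2)], of _ val] M(2)
    by (fastforce simp: marginal_price_def)
qed

text \<open>The price of a sold item is at most the value of its buyer, and an unsold item has price
  0 and hence a profit of at most 0.\<close>

lemma sum_profit_le_welfare:
  assumes E: "E \<subseteq> B \<times> S"
  shows "(\<Sum>j\<in>S. marginal_price E j - c j) \<le> max_welfare v c E"
proof -
  obtain M where M: "is_matching (feasible E) M" "sum val M = max_weight val (feasible E)"
    using max_weight_attained[OF finite_feasible[OF E]] by metis
  have sub: "snd ` M \<subseteq> S" using M(1) E feasible_subset[of E] by (force simp: is_matching_def)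
  have "(\<Sum>j\<in>S. marginal_price E j - c j) \<le> (\<Sum>j\<in>snd ` M. marginal_price E j - c j)"
  proof -
    have "(\<Sum>j\<in>S - snd ` M. marginal_price E j - c j) \<le> 0"
      using marginal_price_unmatched[OF E M] cost_nonneg by (intro sum_nonpos) auto
    then show ?thesis using sum.subset_diff[OF sub finite_S] by (metis add.commute add_le_same_cancel1)
  qed
  also have "\<dots> = (\<Sum>e\<in>M. marginal_price E (snd e) - c (snd e))"
    using M(1) by (subst sum.reindex) (auto simp: is_matching_def)
  also have "\<dots> \<le> (\<Sum>e\<in>M. net_val e)"
    using marginal_price_le_val[OF E M] by (intro sum_mono) auto
  \<comment> \<open>\<open>M\<close> was chosen to maximize value rather than welfare, but as a
    matching its welfare is bounded by the maximum.\<close>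
  also have "\<dots> \<le> max_welfare v c E"
    unfolding max_welfare_eq_max_weight[OF E] using finite_feasible[OF E] M(1) by (rule max_weight_ge)
  finally show ?thesis .
qed

text \<open>An unmatched buyer contributes nothing, and an ordinary matched buyer at most her value
  minus the cost of her item. These bounds add up to the welfare of a matching.\<close>

lemma sum_buyer_marginal_le_welfare:
  assumes E: "G \<subseteq> E" "E \<subseteq> B \<times> S"
  shows "(\<Sum>i\<in>B - dummy ` S. buyer_marginal E i) \<le> max_welfare v c E"
proof -
  obtain M where M: "is_matching (feasible E) M" "sum val M = max_weight val (feasible E)"
    using max_weight_attained[OF finite_feasible[OF E(2)]] by metis
  have finM: "finite M" using finite_matching[OF finite_feasible[OF E(2)] M(1)] .
  have sub: "M \<subseteq> B \<times> S" using M(1) E(2) feasible_subset[of E] by (force simp: is_matching_def)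
  define M' where "M' = {e \<in> M. fst e \<notin> dummy ` S}"
  have M': "is_matching (feasible E) M'" using is_matching_subset[OF M(1)] by (simp add: M'_def)
  have unmatched: "buyer_marginal E i \<le> 0" if "i \<notin> fst ` M" for i
  proof -
    have "sum val M \<le> max_weight val (without_buyer (feasible E) i)"
      using M that finite_feasible[OF E(2)]
      by (intro max_weight_ge) (simp_all add: is_matching_without_buyer)
    then show ?thesis using M(2) by (simp add: buyer_marginal_def)
  qed
  \<comment> \<open>Without buyer \<open>i\<close>, her item \<open>j\<close> can still go to its dummy buyer for \<open>c j\<close>.\<close>
  have matched: "buyer_marginal E (fst e) \<le> net_val e" if "e \<in> M'" for e
  proof -
    obtain i j where ij: "e = (i, j)" by force
    have e: "(i, j) \<in> M" "i \<notin> dummy ` S" "j \<in> S"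
      using that ij sub by (auto simp: M'_def)
    let ?L = "M - {(i, j)}"
    have L: "is_matching (feasible E) ?L" "j \<notin> snd ` ?L" "i \<notin> fst ` ?L"
      using is_matching_subset[OF M(1)] is_matching_unique_fst[OF M(1)]
        is_matching_unique_snd[OF M(1)] e by auto
    have "sum val (insert (dummy j, j) ?L) \<le> max_weight val (without_buyer (feasible E) i)"
      using is_matching_insert_dummy(1)[OF E e(3) L(1,2)] L(3) e finite_feasible[OF E(2)]
      by (intro max_weight_ge) (auto simp: is_matching_without_buyer)
    moreover have "sum val M = val (i, j) + sum val ?L"
      using finM e(1) by (rule sum.remove)
    ultimately show ?thesis
      using is_matching_insert_dummy(2)[OF E e(3) L(1,2)] M(2) ij by (simp add: buyer_marginal_def)
  qed
  have sub': "fst ` M' \<subseteq> B - dummy ` S" using sub by (auto simp: M'_def)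
  have "(\<Sum>i\<in>B - dummy ` S. buyer_marginal E i) \<le> (\<Sum>i\<in>fst ` M'. buyer_marginal E i)"
  proof -
    have "(\<Sum>i\<in>B - dummy ` S - fst ` M'. buyer_marginal E i) \<le> 0"
      using unmatched by (intro sum_nonpos) (force simp: M'_def)
    then show ?thesis
      using sum.subset_diff[OF sub'] finite_B by (metis add.commute add_le_same_cancel1 finite_Diff)
  qed
  also have "\<dots> = (\<Sum>e\<in>M'. buyer_marginal E (fst e))"
    using M' by (subst sum.reindex) (auto simp: is_matching_def)
  also have "\<dots> \<le> (\<Sum>e\<in>M'. net_val e)" using matched by (rule sum_mono)
  also have "\<dots> \<le> max_welfare v c E"
    unfolding max_welfare_eq_max_weight[OF E(2)] using finite_feasible[OF E(2)] M' by (rule max_weight_ge)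
  finally show ?thesis .
qed

text \<open>After \<open>j\<close> joins, \<open>(i, j)\<close> extends an optimal matching of the
  old graph that avoids both ends. By complementarity the latter weighs at least V(E - j) + V(E - i)
  - V(E).\<close>

lemma marginal_price_joined_ge:
  assumes E: "E \<subseteq> B \<times> S" and ij: "i \<in> B" "j \<in> S" "v i j \<noteq> -\<infinity>"
  shows "val (i, j) - buyer_marginal E i \<le> marginal_price (E \<union> B \<times> {j}) j"
proof -
  let ?F = "feasible E" and ?F' = "feasible (E \<union> B \<times> {j})"
  have E': "E \<union> B \<times> {j} \<subseteq> B \<times> S" using E ij by auto
  \<comment> \<open>All edges added by joining end at \<open>j\<close>, so deleting \<open>j\<close>
    removes them again.\<close>
  have same: "without_item ?F' j = without_item ?F j"
    by (auto simp: without_item_def feasible_def)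
  obtain L where L: "is_matching (without_buyer (without_item ?F j) i) L"
    "sum val L = max_weight val (without_buyer (without_item ?F j) i)"
    using max_weight_attained finite_feasible[OF E] finite_without by metis
  then have LF: "is_matching ?F L" "i \<notin> fst ` L" "j \<notin> snd ` L"
    by (auto simp: is_matching_without_item is_matching_without_buyer)
  have "is_matching ?F' L" using LF(1) by (rule is_matching_mono) (auto simp: feasible_def)
  moreover have "(i, j) \<in> ?F'" using ij by (auto simp: feasible_def)
  ultimately have "sum val (insert (i, j) L) \<le> max_weight val ?F'"
    using LF finite_feasible[OF E'] by (intro max_weight_ge is_matching_insert)
  moreover have "sum val (insert (i, j) L) = val (i, j) + sum val L"
    using LF finite_matching[OF finite_feasible[OF E] LF(1)] by (intro sum.insert) force+
  ultimately show ?thesis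
    using max_weight_complements[OF finite_feasible[OF E], of val j i] L(2)
    by (simp add: marginal_price_def buyer_marginal_def same)
qed

lemma buyer_marginal_nonneg: "E \<subseteq> B \<times> S \<Longrightarrow> 0 \<le> buyer_marginal E i"
  unfolding buyer_marginal_def
  using max_weight_mono[of "feasible E" "without_buyer (feasible E) i" val] finite_feasible[of E]
  by (auto simp: without_buyer_def)

text \<open>Here each seller joins alone, starting from the same graph. The bound for a single
  joining seller is summed over the pairs with ordinary buyers in a welfare optimum of the complete
  graph.\<close>

lemma sum_joined_prices_ge:
  assumes E: "G \<subseteq> E" "E \<subseteq> B \<times> S"
  shows "optimal_welfare S B v c + (\<Sum>j\<in>S. c j) - max_welfare v c E
    \<le> (\<Sum>j\<in>S. marginal_price (E \<union> B \<times> {j}) j)"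
proof -
  let ?K = "B \<times> S" and ?p = "\<lambda>j. marginal_price (E \<union> B \<times> {j}) j"
  obtain M where M: "is_matching (feasible ?K) M" "sum net_val M = max_weight net_val (feasible ?K)"
    using max_weight_attained[OF finite_feasible[OF order_refl]] by metis
  have finM: "finite M" using finite_matching[OF finite_feasible[OF order_refl] M(1)] .
  have sub: "M \<subseteq> B \<times> S" using M(1) feasible_subset[of ?K] by (force simp: is_matching_def)
  define M' where "M' = {e \<in> M. fst e \<notin> dummy ` S}"
  have M': "is_matching (feasible ?K) M'" using is_matching_subset[OF M(1)] by (simp add: M'_def)
  \<comment> \<open>A dummy buyer pays exactly the cost in value, so dummy pairs add no welfare and
    \<open>M'\<close> carries the whole optimum.\<close>
  have dummy_net: "net_val e = 0" if e: "e \<in> M - M'" for e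
  proof -
    obtain i j where ij: "e = (i, j)" by force
    then obtain k where k: "k \<in> S" "i = dummy k" using e by (auto simp: M'_def)
    then have "j = k"
      using feasible_dummy_unique[OF order_refl, of k j] e M(1) ij by (auto simp: is_matching_def)
    then show ?thesis using k ij val_dummy by simp
  qed
  have "optimal_welfare S B v c = sum net_val M"
    by (simp add: optimal_welfare_def max_welfare_eq_max_weight M(2))
  also have "\<dots> = sum net_val M'"
    using finM dummy_net by (intro sum.mono_neutral_right) (auto simp: M'_def)
  finally have opt: "optimal_welfare S B v c = sum net_val M'" .
  have "(\<Sum>e\<in>M'. net_val e - buyer_marginal E (fst e)) \<le> (\<Sum>e\<in>M'. ?p (snd e) - c (snd e))"
  proof (rule sum_mono)
    fix e assume "e \<in> M'"
    then have "e \<in> feasible ?K" using M' by (auto simp: is_matching_def)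
    then show "net_val e - buyer_marginal E (fst e) \<le> ?p (snd e) - c (snd e)"
      using marginal_price_joined_ge[OF E(2), of "fst e" "snd e"]
      by (auto simp: feasible_def)
  qed
  also have "\<dots> = (\<Sum>j\<in>snd ` M'. ?p j - c j)"
    using M' by (subst sum.reindex) (auto simp: is_matching_def)
  \<comment> \<open>The remaining sellers can be included because dummy buyers keep every price at
    or above cost.\<close>
  also have "\<dots> \<le> (\<Sum>j\<in>S. ?p j - c j)"
  proof (rule sum_mono2[OF finite_S])
    show "snd ` M' \<subseteq> S" using sub by (auto simp: M'_def)
    show "0 \<le> ?p j - c j" if "j \<in> S - snd ` M'" for j
      using cost_le_marginal_price[of "E \<union> B \<times> {j}" j] E that by auto
  qed
  finally have "sum net_val M' - (\<Sum>e\<in>M'. buyer_marginal E (fst e)) \<le> (\<Sum>j\<in>S. ?p j) - (\<Sum>j\<in>S. c j)"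
    by (simp add: sum_subtractf)
  moreover have "(\<Sum>e\<in>M'. buyer_marginal E (fst e)) \<le> (\<Sum>i\<in>B - dummy ` S. buyer_marginal E i)"
  proof -
    have "(\<Sum>e\<in>M'. buyer_marginal E (fst e)) = (\<Sum>i\<in>fst ` M'. buyer_marginal E i)"
      using M' by (subst sum.reindex) (auto simp: is_matching_def)
    also have "\<dots> \<le> (\<Sum>i\<in>B - dummy ` S. buyer_marginal E i)"
      using sub finite_B buyer_marginal_nonneg[OF E(2)] by (intro sum_mono2) (auto simp: M'_def)
    finally show ?thesis .
  qed
  ultimately show ?thesis using sum_buyer_marginal_le_welfare[OF E] opt by linarith
qed

end

section \<open>Platform equilibria\<close>

lemma finite_set_joining_sellers:
  assumes "finite T" shows "finite (set_pmf (joining_sellers T x))"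
  by (rule finite_subset[of _ "Pow T"]) (use assms in \<open>auto simp: joining_sellers_def\<close>)

lemma set_joining_sellers: "P \<in> set_pmf (joining_sellers T x) \<Longrightarrow> P \<subseteq> T"
  by (auto simp: joining_sellers_def)

text \<open>Once \<open>j\<close> is inserted, her own coin is irrelevant. This rewrites the
  deviation of \<open>j\<close> to joining as an expectation over the distribution shared by all
  sellers.\<close>

lemma insert_joining_sellers_remove:
  assumes "finite S" "j \<in> S"
  shows "map_pmf (insert j) (joining_sellers (S - {j}) x) = map_pmf (insert j) (joining_sellers S x)"
  unfolding joining_sellers_def
  \<comment> \<open>\<open>Pi_pmf_subset\<close> resets coordinate \<open>j\<close> to the default
    \<open>False\<close>, which inserting \<open>j\<close> hides.\<close>
  by (subst Pi_pmf_subset[OF assms(1), of "S - {j}"])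
     (auto simp: map_pmf_comp assms intro!: map_pmf_cong)

lemma platform_graph_insert: "platform_graph B G (insert j P) = platform_graph B G P \<union> B \<times> {j}"
  by (auto simp: platform_graph_def)

section \<open>Expected welfare in equilibrium and the price of anarchy\<close>

context costly_market
begin

text \<open>The total expected utility of the sellers is squeezed: at least what they would get by
  joining one at a time, and at most the expected welfare.\<close>

lemma equilibrium_welfare_ge:
  assumes \<alpha>: "0 \<le> \<alpha>" "\<alpha> < 1" and x: "platform_equilibrium S B v c G \<alpha> x"
  shows "(1 - \<alpha>) * optimal_welfare S B v c - \<alpha> * (\<Sum>j\<in>S. c j)
    \<le> (2 - \<alpha>) * measure_pmf.expectation (joining_sellers S x)
        (\<lambda>P. max_welfare v c (platform_graph B G P))"
proof -
  let ?D = "joining_sellers S x" and ?G = "platform_graph B G"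
  let ?E = "measure_pmf.expectation ?D" and ?W = "\<lambda>P. max_welfare v c (platform_graph B G P)"
  let ?opt = "optimal_welfare S B v c" and ?C = "\<Sum>j\<in>S. c j"
  let ?u = "\<lambda>P j. seller_utility S B v c G \<alpha> P j"
  have int: "integrable ?D f" for f :: "'s set \<Rightarrow> real"
    using finite_set_joining_sellers[OF finite_S] by (rule integrable_measure_pmf_finite)
  have graph: "G \<subseteq> ?G P" "?G P \<subseteq> B \<times> S" if "P \<subseteq> S" for P
    using G_subset that by (auto simp: platform_graph_def)
  have mono: "?E f \<le> ?E g" if "\<And>P. P \<subseteq> S \<Longrightarrow> f P \<le> g P" for f g :: "'s set \<Rightarrow> real"
    by (intro integral_mono_AE int)
       (simp add: AE_measure_pmf_iff, blast intro: that dest: set_joining_sellers)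
  have join: "?E (\<lambda>P. ?u (insert j P) j) \<le> ?E (\<lambda>P. ?u P j)" if "j \<in> S" for j
  proof -
    have "?E (\<lambda>P. ?u (insert j P) j) = measure_pmf.expectation (map_pmf (insert j) ?D) (\<lambda>P. ?u P j)"
      by simp
    also have "\<dots> = measure_pmf.expectation (joining_sellers (S - {j}) x) (\<lambda>P. ?u (P \<union> {j}) j)"
      unfolding insert_joining_sellers_remove[OF finite_S that, symmetric] by simp
    finally show ?thesis using x that by (simp add: platform_equilibrium_def)
  qed
  have "(1 - \<alpha>) * (?opt + ?C - ?E ?W) - ?C = ?E (\<lambda>P. (1 - \<alpha>) * (?opt + ?C - ?W P) - ?C)"
    using int by simp
  also have "\<dots> \<le> ?E (\<lambda>P. \<Sum>j\<in>S. ?u (insert j P) j)"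
  proof (rule mono)
    fix P assume P: "P \<subseteq> S"
    have "(\<Sum>j\<in>S. ?u (insert j P) j) = (\<Sum>j\<in>S. (1 - \<alpha>) * marginal_price (?G P \<union> B \<times> {j}) j - c j)"
    proof (rule sum.cong[OF refl])
      fix j assume j: "j \<in> S"
      then have "?G (insert j P) \<subseteq> B \<times> S" using P by (intro graph) auto
      from max_price_eq_marginal_price[OF this j]
      show "?u (insert j P) j = (1 - \<alpha>) * marginal_price (?G P \<union> B \<times> {j}) j - c j"
        by (simp add: seller_utility_def platform_graph_insert)
    qed
    also have "\<dots> = (1 - \<alpha>) * (\<Sum>j\<in>S. marginal_price (?G P \<union> B \<times> {j}) j) - ?C"
      by (simp add: sum_subtractf sum_distrib_left)
    finally show "(1 - \<alpha>) * (?opt + ?C - ?W P) - ?C \<le> (\<Sum>j\<in>S. ?u (insert j P) j)"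
      using mult_left_mono[OF sum_joined_prices_ge[OF graph[OF P]], of "1 - \<alpha>"] \<alpha> by simp
  qed
  also have "\<dots> = (\<Sum>j\<in>S. ?E (\<lambda>P. ?u (insert j P) j))" using int by (intro Bochner_Integration.integral_sum)
  also have "\<dots> \<le> (\<Sum>j\<in>S. ?E (\<lambda>P. ?u P j))" using join by (rule sum_mono)
  also have "\<dots> = ?E (\<lambda>P. \<Sum>j\<in>S. ?u P j)" using int by (intro Bochner_Integration.integral_sum[symmetric])
  also have "\<dots> \<le> ?E ?W"
  proof (rule mono)
    fix P assume P: "P \<subseteq> S"
    \<comment> \<open>Prices are nonnegative, so the fee can only lower a seller's utility below
      price minus cost.\<close>
    have "(\<Sum>j\<in>S. ?u P j) \<le> (\<Sum>j\<in>S. marginal_price (?G P) j - c j)"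
    proof (rule sum_mono)
      fix j assume "j \<in> S"
      moreover have "(1 - \<alpha>) * marginal_price (?G P) j \<le> marginal_price (?G P) j"
        using \<alpha> marginal_price_nonneg[OF graph(2)[OF P], of j] by (simp add: mult_left_le_one_le)
      ultimately show "?u P j \<le> marginal_price (?G P) j - c j"
        using max_price_eq_marginal_price[OF graph(2)[OF P]] by (simp add: seller_utility_def)
    qed
    then show "(\<Sum>j\<in>S. ?u P j) \<le> ?W P" using sum_profit_le_welfare[OF graph(2)[OF P]] by linarith
  qed
  finally show ?thesis by (simp add: algebra_simps)
qed

lemma optimal_welfare_nonneg: "0 \<le> optimal_welfare S B v c"
  unfolding optimal_welfare_def max_welfare_eq_max_weight[OF order_refl]
  using max_weight_ge[OF finite_feasible[OF order_refl] is_matching_empty, of net_val] by simp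

end

lemma costly_market_if_market_with_costs:
  assumes "market_with_costs S B v c G"
  obtains dummy where "costly_market S B v c G dummy"
proof -
  obtain dummy where *: "finite S" "finite B" "G \<subseteq> B \<times> S" "\<forall>j\<in>S. 0 \<le> c j" "inj_on dummy S" "dummy ` S \<subseteq> B"
    "\<forall>j\<in>S. (dummy j, j) \<in> G \<and> v (dummy j) j = ereal (c j) \<and> (\<forall>k\<in>S. k \<noteq> j \<longrightarrow> v (dummy j) k = -\<infinity>)"
    "\<forall>i\<in>B - dummy ` S. \<forall>j\<in>S. 0 \<le> v i j \<and> v i j < \<infinity>"
    using assms unfolding market_with_costs_def by (elim conjE exE) (rule that)
  have "v i j \<noteq> \<infinity>" if ij: "i \<in> B" "j \<in> S" for i j
  proof (cases "i \<in> dummy ` S")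
    case True
    then obtain k where k: "k \<in> S" "i = dummy k" by auto
    then show ?thesis using *(7) ij by (cases "j = k") auto
  next
    case False
    then show ?thesis using *(8) ij by auto
  qed
  then have "costly_market S B v c G dummy"
    using * by unfold_locales auto
  then show ?thesis using that by blast
qed

theorem theorem6p2:
  fixes S :: "'s set" and B :: "'b set"
    and v :: "'b \<Rightarrow> 's \<Rightarrow> ereal" and c :: "'s \<Rightarrow> real"
    and G :: "('b \<times> 's) set" and \<alpha> \<beta> :: real
  assumes "market_with_costs S B v c G"
    and "0 \<le> \<alpha>" and "\<alpha> < 1"
    and "\<beta> = (\<Sum>j\<in>S. c j) / optimal_welfare S B v c"
    and "0 < 1 - \<alpha> - \<alpha> * \<beta>"
  shows "price_of_anarchy S B v c G \<alpha> \<le> ereal ((2 - \<alpha>) / (1 - \<alpha> - \<alpha> * \<beta>))"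
proof -
  let ?opt = "optimal_welfare S B v c" and ?C = "\<Sum>j\<in>S. c j"
  let ?k = "1 - \<alpha> - \<alpha> * \<beta>"
  obtain dummy where "costly_market S B v c G dummy"
    using costly_market_if_market_with_costs assms(1) .
  then interpret costly_market S B v c G dummy .
  show ?thesis
    unfolding price_of_anarchy_def
  proof (rule SUP_least)
    fix x assume "x \<in> {x. platform_equilibrium S B v c G \<alpha> x}"
    then have x: "platform_equilibrium S B v c G \<alpha> x" by simp
    define W where
      "W = measure_pmf.expectation (joining_sellers S x) (\<lambda>P. max_welfare v c (platform_graph B G P))"
    have "ereal ?opt / ereal W \<le> ereal ((2 - \<alpha>) / ?k)"
    \<comment> \<open>With optimal welfare 0 the extended-real quotient is 0 for every
      \<open>W\<close>, and the bound is nonnegative.\<close>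
    proof (cases "?opt = 0")
      case True
      then show ?thesis using assms(2,3,5) by (simp add: zero_ereal_def[symmetric])
    next
      case False
      then have opt: "0 < ?opt" using optimal_welfare_nonneg by linarith
      then have C: "?C = \<beta> * ?opt" using assms(4) by simp
      have "?k * ?opt \<le> (2 - \<alpha>) * W"
        using equilibrium_welfare_ge[OF assms(2,3) x] unfolding W_def C by (simp add: algebra_simps)
      \<comment> \<open>Positive expected welfare rules out the quotient \<infinity>, so the
        division is the one of the reals.\<close>
      moreover from this have "0 < W"
        using mult_pos_pos[OF assms(5) opt] assms(3) by (smt (verit) mult_nonneg_nonpos)
      ultimately show ?thesis using assms(5) by (simp add: field_simps)
    qed
    then show "ereal ?opt / ereal (measure_pmf.expectation (joining_sellers S x)
        (\<lambda>P. max_welfare v c (platform_graph B G P))) \<le> ereal ((2 - \<alpha>) / ?k)"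
      unfolding W_def .
  qed
qed

end
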